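(* Let $\mathbb{A}_2\subseteq 2^\omega\times 2^\omega$ be the set of pairs $(\alpha,\beta)$ for which there is $n\in\omega$ such that: for all $i<n$, $(\alpha)_i=(\beta)_i$ and the finite sequence $0^{t_n(i)}1$ ($t_n(i)$ zeros followed by a one) is an initial segment of $((\alpha)_i)^*$; $((\alpha)_n,(\beta)_n)=(0^\infty,10^\infty)$; and $(\alpha)_i=(\beta)_i$ for all $i>n$. Then for every Polish space $X$ and every analytic set $A\subseteq X\times X$, exactly one of the following holds: (a) there is a ${\bf\Delta}^0_2$-measurable map $c:X\rightarrow\omega$ with $c(x)\neq c(y)$ for all $(x,y)\in A$; (b) there is a continuous map $f:2^\omega\rightarrow X$ with $(f(\alpha),f(\beta))\in A$ for all $(\alpha,\beta)\in\mathbb{A}_2$.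
   Context: Let $\langle n,p\rangle:=(\sum_{k\leq n+p}k)+p$, a bijection $\omega^2\to\omega$, with inverse $q\mapsto((q)_0,(q)_1)$. For $\alpha\in 2^\omega$ and $n\in\omega$, $(\alpha)_n\in 2^\omega$ is defined by $(\alpha)_n(p):=\alpha(\langle n,p\rangle)$. For $\alpha\in 2^\omega$, $\alpha^*$ is the shift: $\alpha^*(j):=\alpha(j+1)$. The sequence $(t_n)_{n\in\omega}$ in $\omega^{<\omega}$ (with $|t_n|=n$) is defined as follows: let $(p_n)$ be the increasing enumeration of the primes, $I(\emptyset):=1$ and $I(s):=p_0^{s(0)+1}\cdots p_{|s|-1}^{s(|s|-1)+1}$ for $s\neq\emptyset$; let $i$ be the increasing bijection from $I[\omega^{<\omega}]$ onto $\omega$, $\psi:=(i\circ I)^{-1}:\omega\to\omega^{<\omega}$ (one has $|\psi(n)|\leq n$), and $t_n:=\psi(n)0^{n-|\psi(n)|}$ ($\psi(n)$ followed by $n-|\psi(n)|$ zeros). A map $c:X\to\omega$ is ${\bf\Delta}^0_2$-measurable if each $c^{-1}(\{k\})$ is ${\bf\Delta}^0_2$ in $X$. *)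

theory Defs
  imports "HOL-Analysis.Analysis"
begin

section \<open>Descriptive set theory\<close>

definition Polish_topology :: "'a topology \<Rightarrow> bool" where
  "Polish_topology X \<longleftrightarrow> completely_metrizable_space X \<and> separable_space X"

definition Cantor_space :: "(nat \<Rightarrow> bool) topology" where
  "Cantor_space = product_topology (\<lambda>_. discrete_topology UNIV) UNIV"

definition Baire_space :: "(nat \<Rightarrow> nat) topology" where
  "Baire_space = product_topology (\<lambda>_. discrete_topology UNIV) UNIV"

text \<open>Only meant for Polish \<open>Y\<close>. The empty set is analytic but not an image of the Baire space,
  hence the first disjunct.\<close>

definition analytic_in :: "'a topology \<Rightarrow> 'a set \<Rightarrow> bool" where
  "analytic_in Y A \<longleftrightarrow>
     A = {} \<or> (\<exists>g. continuous_map Baire_space Y g \<and> g ` topspace Baire_space = A)"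

text \<open>The pointclass \<open>\<Delta>\<^sup>0\<^sub>2\<close> of a metrizable space: \<open>\<Sigma>\<^sup>0\<^sub>2\<close> is \<open>F\<^sub>\<sigma>\<close> and \<open>\<Pi>\<^sup>0\<^sub>2\<close> is \<open>G\<^sub>\<delta>\<close>.\<close>

definition Delta02_in :: "'a topology \<Rightarrow> 'a set \<Rightarrow> bool" where
  "Delta02_in X S \<longleftrightarrow> fsigma_in X S \<and> gdelta_in X S"

definition Delta02_measurable :: "'a topology \<Rightarrow> ('a \<Rightarrow> nat) \<Rightarrow> bool" where
  "Delta02_measurable X c \<longleftrightarrow> (\<forall>k. Delta02_in X {x \<in> topspace X. c x = k})"

section \<open>The sequence of finite sequences \<open>t\<^sub>n\<close>\<close>

definition nth_prime :: "nat \<Rightarrow> nat" where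
  "nth_prime = enumerate {p. prime p}"

definition seq_code :: "nat list \<Rightarrow> nat" where
  "seq_code s = (\<Prod>i<length s. nth_prime i ^ (s ! i + 1))"

text \<open>Counting the smaller codes is the increasing bijection from \<open>range seq_code\<close> onto the
  natural numbers.\<close>

definition code_rank :: "nat \<Rightarrow> nat" where
  "code_rank m = card {k \<in> range seq_code. k < m}"

definition psi :: "nat \<Rightarrow> nat list" where
  "psi = inv (code_rank \<circ> seq_code)"

text \<open>As \<open>length (psi n) \<le> n\<close>, the subtraction does not truncate and \<open>t_seq n\<close> has length \<open>n\<close>.\<close>

definition t_seq :: "nat \<Rightarrow> nat list" where
  "t_seq n = psi n @ replicate (n - length (psi n)) 0"

section \<open>The relation \<open>\<bbbA>\<^sub>2\<close> on the Cantor space\<close>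

text \<open>Not \<open>prod_encode\<close>, which is increasing in its first argument along the diagonals.\<close>

definition pair_code :: "nat \<Rightarrow> nat \<Rightarrow> nat" where
  "pair_code n p = (\<Sum>k\<le>n + p. k) + p"

definition section_of :: "(nat \<Rightarrow> bool) \<Rightarrow> nat \<Rightarrow> nat \<Rightarrow> bool" where
  "section_of \<alpha> n = (\<lambda>p. \<alpha> (pair_code n p))"

definition shift :: "(nat \<Rightarrow> 'b) \<Rightarrow> nat \<Rightarrow> 'b" where
  "shift \<alpha> = (\<lambda>j. \<alpha> (j + 1))"

definition initial_segment :: "'b list \<Rightarrow> (nat \<Rightarrow> 'b) \<Rightarrow> bool" where
  "initial_segment s \<alpha> \<longleftrightarrow> (\<forall>j<length s. \<alpha> j = s ! j)"

text \<open>The digits 0 and 1 are \<^term>\<open>False\<close> and \<^term>\<open>True\<close>; in particular \<open>\<lambda>p. p = 0\<close> is the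
  sequence consisting of a one followed by zeros.\<close>

definition A2 :: "((nat \<Rightarrow> bool) \<times> (nat \<Rightarrow> bool)) set" where
  "A2 = {(\<alpha>, \<beta>). \<exists>n.
     (\<forall>i<n. section_of \<alpha> i = section_of \<beta> i \<and>
        initial_segment (replicate (t_seq n ! i) False @ [True]) (shift (section_of \<alpha> i))) \<and>
     section_of \<alpha> n = (\<lambda>p. False) \<and> section_of \<beta> n = (\<lambda>p. p = 0) \<and>
     (\<forall>i>n. section_of \<alpha> i = section_of \<beta> i)}"

end

theory Submission
  imports Defs
begin

text \<open>A \<open>\<Delta>\<^sup>0\<^sub>2\<close>-measurable colouring exists iff \<open>X\<close> is a countable union of closed sets \<open>C\<close> with
  \<open>A \<inter> C \<times> C = {}\<close>.  If there is no such cover, remove from \<open>X\<close> all basic open sets that have one: what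
  remains is a nonempty closed set \<open>Y\<close> in which \<open>A\<close> meets \<open>V \<times> V\<close> for every nonempty open \<open>V\<close>.
  A homomorphism is then built from nested balls in \<open>Y\<close>.  Given the ball of the first \<open>n\<close> sections,
  choose a pair \<open>(y\<^sub>0, y\<^sub>1)\<close> of \<open>A\<close> in it; if section \<open>n\<close> is \<open>\<epsilon>0\<^sup>\<infinity>\<close>, the value is \<open>y\<^sub>\<epsilon>\<close>, and if it begins
  with \<open>\<epsilon>0\<^sup>k1\<close>, pass to a ball around \<open>y\<^sub>\<epsilon>\<close> whose radius vanishes as \<open>k\<close> grows.  Conversely, a
  colouring and a homomorphism together would write the Cantor space as a countable union of closed
  sets avoiding \<open>\<bbbA>\<^sub>2\<close>; by Baire one of them contains a cylinder, but as every finite sequence is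
  extended by some \<open>t\<^sub>n\<close>, the relation \<open>\<bbbA>\<^sub>2\<close> meets the square of every cylinder.\<close>

section \<open>The sequence \<open>t\<^sub>n\<close> is dense\<close>

lemma prime_nth_prime: "prime (nth_prime i)"
  using enumerate_in_set[OF primes_infinite] by (simp add: nth_prime_def)

lemma inj_nth_prime: "inj nth_prime"
  using strict_mono_imp_inj_on[OF strict_mono_enumerate[OF primes_infinite]] by (simp add: nth_prime_def)

text \<open>Unique factorization: the \<open>+ 1\<close> in the exponents separates an entry 0 from
  a missing entry, so the multiplicities determine both length and entries.\<close>

lemma multiplicity_seq_code:
  "multiplicity (nth_prime i) (seq_code s) = (if i < length s then s ! i + 1 else 0)"
proof -
  have "seq_code s = (\<Prod>p\<in>nth_prime ` {..<length s}. p ^ (s ! (inv nth_prime p) + 1))"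
    unfolding seq_code_def using inj_nth_prime
    by (subst prod.reindex) (auto intro: inj_on_subset)
  then have "multiplicity (nth_prime i) (seq_code s) =
      (if nth_prime i \<in> nth_prime ` {..<length s} then s ! (inv nth_prime (nth_prime i)) + 1 else 0)"
    using prime_nth_prime by (simp only:) (subst multiplicity_prod_prime_powers, auto)
  then show ?thesis
    using inj_nth_prime by (simp add: inj_image_mem_iff)
qed

lemma inj_seq_code: "inj seq_code"
proof (rule injI)
  fix s t assume "seq_code s = seq_code t"
  then have eq: "(if i < length s then s ! i + 1 else 0) = (if i < length t then t ! i + 1 else 0)" for i
    by (metis multiplicity_seq_code)
  then have "i < length s \<longleftrightarrow> i < length t" for i
    by (metis Suc_eq_plus1 Zero_not_Suc)
  then have "length s = length t"
    by (metis linorder_neqE_nat order_less_irrefl)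
  then show "s = t"
    using eq by (metis add_right_cancel nth_equalityI)
qed

text \<open>\<open>k\<close> itself is counted for \<open>m\<close> but not for
  \<open>k\<close>.\<close>

lemma code_rank_strict_mono:
  assumes "k < m" "k \<in> range seq_code"
  shows "code_rank k < code_rank m"
  unfolding code_rank_def by (rule psubset_card_mono) (use assms in auto)

lemma psi_code_rank: "psi (code_rank (seq_code s)) = s"
proof -
  have "inj (code_rank \<circ> seq_code)"
  proof (rule injI)
    fix s t assume "(code_rank \<circ> seq_code) s = (code_rank \<circ> seq_code) t"
    then have "seq_code s = seq_code t"
      using code_rank_strict_mono by (metis comp_apply linorder_neqE_nat order_less_irrefl rangeI)
    then show "s = t"
      using inj_seq_code by (simp add: inj_eq)
  qed
  then show ?thesis
    unfolding psi_def by (metis comp_apply inv_f_f)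
qed

text \<open>Padding \<open>s\<close> with zeros gives infinitely many sequences that begin with
  \<open>s\<close>, so their indices under \<open>psi\<close> are unbounded.\<close>

lemma t_seq_extends:
  obtains n where "m \<le> n" "\<And>i. i < length s \<Longrightarrow> t_seq n ! i = s ! i"
proof -
  define e where "e j = code_rank (seq_code (s @ replicate j 0))" for j
  have psi: "psi (e j) = s @ replicate j 0" for j
    by (simp add: e_def psi_code_rank)
  have "inj e"
    by (rule injI) (metis psi length_replicate same_append_eq)
  then have "infinite (range e)"
    by (simp add: finite_image_iff)
  then obtain j where "m \<le> e j"
    by (metis infinite_nat_iff_unbounded_le rangeE)
  moreover have "t_seq (e j) ! i = s ! i" if "i < length s" for i
    using that by (simp add: t_seq_def psi nth_append)
  ultimately show thesis
    using that by blast
qed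

section \<open>The Cantor space\<close>

lemma pair_code_eq_prod_encode: "pair_code n p = prod_encode (p, n)"
  by (simp add: pair_code_def prod_encode_def triangle_def gauss_sum_nat atMost_atLeast0 add.commute)

lemma le_pair_code: "n \<le> pair_code n p" "p \<le> pair_code n p"
  by (simp_all add: pair_code_eq_prod_encode le_prod_encode_1 le_prod_encode_2)

text \<open>The inverse of splitting a sequence into its sections; elements of \<open>A2\<close> are
  built with it.\<close>

definition join :: "(nat \<Rightarrow> nat \<Rightarrow> bool) \<Rightarrow> nat \<Rightarrow> bool" where
  "join \<sigma> x = (case prod_decode x of (p, n) \<Rightarrow> \<sigma> n p)"

lemma section_of_join: "section_of (join \<sigma>) n = \<sigma> n"
  by (simp add: section_of_def join_def pair_code_eq_prod_encode)

lemma obtain_pair_code: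
  obtains n p where "x = pair_code n p"
  by (metis pair_code_eq_prod_encode prod_decode_inverse surj_pair)

lemma join_pair_code: "join \<sigma> (pair_code n p) = \<sigma> n p"
  by (simp add: join_def pair_code_eq_prod_encode)

lemma topspace_Cantor_space [simp]: "topspace Cantor_space = UNIV"
  by (simp add: Cantor_space_def)

lemma openin_Cantor_space:
  "openin Cantor_space U \<longleftrightarrow> (\<forall>\<alpha>\<in>U. \<exists>L. \<forall>\<beta>. (\<forall>j<L. \<beta> j = \<alpha> j) \<longrightarrow> \<beta> \<in> U)"
proof
  assume U: "openin Cantor_space U"
  show "\<forall>\<alpha>\<in>U. \<exists>L. \<forall>\<beta>. (\<forall>j<L. \<beta> j = \<alpha> j) \<longrightarrow> \<beta> \<in> U"
  proof
    fix \<alpha> assume "\<alpha> \<in> U"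
    then obtain W where W: "finite {i. W i \<noteq> (UNIV :: bool set)}" "\<alpha> \<in> Pi\<^sub>E UNIV W" "Pi\<^sub>E UNIV W \<subseteq> U"
      using U by (auto simp: Cantor_space_def openin_product_topology_alt)
    \<comment> \<open>A basic box restricts finitely many coordinates, all below some
      \<open>L\<close>.\<close>
    obtain L where L: "\<And>i. W i \<noteq> UNIV \<Longrightarrow> i < L"
      using finite_nat_bounded[OF W(1)] by blast
    have "\<beta> \<in> U" if "\<forall>j<L. \<beta> j = \<alpha> j" for \<beta>
    proof -
      have "\<beta> i \<in> W i" for i
        using W(2) that L[of i] by (cases "W i = UNIV") (auto simp: PiE_iff)
      then show ?thesis
        using W(3) by auto
    qed
    then show "\<exists>L. \<forall>\<beta>. (\<forall>j<L. \<beta> j = \<alpha> j) \<longrightarrow> \<beta> \<in> U"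
      by blast
  qed
next
  assume *: "\<forall>\<alpha>\<in>U. \<exists>L. \<forall>\<beta>. (\<forall>j<L. \<beta> j = \<alpha> j) \<longrightarrow> \<beta> \<in> U"
  show "openin Cantor_space U"
    unfolding Cantor_space_def openin_product_topology_alt
  proof
    fix \<alpha> assume "\<alpha> \<in> U"
    then obtain L where L: "\<And>\<beta>. (\<forall>j<L. \<beta> j = \<alpha> j) \<Longrightarrow> \<beta> \<in> U"
      using * by blast
    let ?W = "\<lambda>i. if i < L then {\<alpha> i} else UNIV"
    have "finite {i. ?W i \<noteq> UNIV}"
      by (rule finite_subset[of _ "{..<L}"]) auto
    moreover have "Pi\<^sub>E UNIV ?W \<subseteq> U"
      by (auto simp: PiE_iff split: if_splits intro!: L)
    ultimately show "\<exists>W. finite {i \<in> UNIV. W i \<noteq> topspace (discrete_topology (UNIV :: bool set))} \<and>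
        (\<forall>i\<in>UNIV. openin (discrete_topology UNIV) (W i)) \<and> \<alpha> \<in> Pi\<^sub>E UNIV W \<and> Pi\<^sub>E UNIV W \<subseteq> U"
      by (intro exI[of _ ?W]) auto
  qed
qed

text \<open>Compact Hausdorff spaces are locally compact and regular, so the Baire category theorem
  yields a member with nonempty interior, and this interior contains a cylinder.\<close>

lemma Cantor_space_Baire:
  assumes "countable \<G>" "\<And>T. T \<in> \<G> \<Longrightarrow> closedin Cantor_space T" "\<Union>\<G> = UNIV"
  obtains T \<alpha> L where "T \<in> \<G>" "\<And>\<beta>. (\<forall>j<L. \<beta> j = \<alpha> j) \<Longrightarrow> \<beta> \<in> T"
proof -
  have "compact_space Cantor_space" "Hausdorff_space Cantor_space"
    by (simp_all add: Cantor_space_def compact_space_product_topology Hausdorff_space_product_topology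
        compact_space_discrete_topology)
  then have "locally_compact_space Cantor_space \<and> regular_space Cantor_space"
    using compact_imp_locally_compact_space compact_Hausdorff_imp_regular_space by blast
  moreover have "Cantor_space interior_of \<Union>\<G> \<noteq> {}"
    using interior_of_topspace[of Cantor_space] by (simp add: assms(3))
  ultimately obtain T where T: "T \<in> \<G>" "Cantor_space interior_of T \<noteq> {}"
    using Baire_category_alt[OF disjI2 assms(1), of Cantor_space] assms(2) by blast
  then obtain \<alpha> where "\<alpha> \<in> Cantor_space interior_of T"
    by blast
  then obtain L where "\<And>\<beta>. (\<forall>j<L. \<beta> j = \<alpha> j) \<Longrightarrow> \<beta> \<in> Cantor_space interior_of T"
    using openin_interior_of[of Cantor_space T] unfolding openin_Cantor_space by metis
  then have "\<And>\<beta>. (\<forall>j<L. \<beta> j = \<alpha> j) \<Longrightarrow> \<beta> \<in> T"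
    using interior_of_subset[of Cantor_space T] by (meson subsetD)
  then show thesis
    by (rule that[OF T(1)])
qed

text \<open>Since \<open>i \<le> pair_code i p\<close>, a cylinder of length \<open>L\<close>
  constrains only sections with index below \<open>L\<close>. These are completed first; density
  then gives an \<open>n \<ge> L\<close> for which \<open>t_seq n\<close> fits them.\<close>

lemma A2_meets_cylinder:
  obtains \<beta> \<gamma> where "(\<beta>, \<gamma>) \<in> A2" "\<forall>j<L. \<beta> j = \<alpha> j" "\<forall>j<L. \<gamma> j = \<alpha> j"
proof -
  \<comment> \<open>Filling up with ones puts a one after position 0 into every section;
    \<open>k i\<close> counts the zeros before it.\<close>
  define \<delta> where "\<delta> x = (if x < L then \<alpha> x else True)" for x
  define k where "k i = (LEAST j. section_of \<delta> i (Suc j))" for i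
  have "section_of \<delta> i (Suc L)" for i
    using le_pair_code(2)[where n = i and p = "Suc L"] by (auto simp: section_of_def \<delta>_def)
  then have k: "section_of \<delta> i (Suc (k i))" "\<And>j. j < k i \<Longrightarrow> \<not> section_of \<delta> i (Suc j)" for i
    unfolding k_def by (metis LeastI) (metis not_less_Least)
  obtain n where n: "L \<le> n" and t: "\<And>i. i < L \<Longrightarrow> t_seq n ! i = k i"
    using t_seq_extends[of L "map k [0..<L]"] by auto
  \<comment> \<open>\<open>b\<close> is visible in section \<open>n\<close> only. The other sections
    from \<open>L\<close> on have their single one at \<open>Suc (t_seq n ! i)\<close>, because
    \<open>shift\<close> drops position 0.\<close>
  define \<sigma> where "\<sigma> b i p = (if i < L then section_of \<delta> i p
      else if i = n then b \<and> p = 0 else p = Suc (t_seq n ! i))" for b i p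
  have "join (\<sigma> b) j = \<alpha> j" if "j < L" for b j
  proof -
    obtain i p where j: "j = pair_code i p"
      by (rule obtain_pair_code)
    then have "i < L"
      using le_pair_code(1)[of i p] \<open>j < L\<close> by simp
    then show ?thesis
      using that by (simp add: j join_pair_code \<sigma>_def section_of_def \<delta>_def)
  qed
  moreover have "(join (\<sigma> False), join (\<sigma> True)) \<in> A2"
    unfolding A2_def
  proof (clarsimp simp: section_of_join, intro exI[of _ n] conjI allI impI)
    fix i assume "i < n"
    then show "initial_segment (replicate (t_seq n ! i) False @ [True]) (shift (\<sigma> False i))"
      using k(1)[of i] k(2)[of _ i] t[of i]
      by (auto simp: initial_segment_def shift_def \<sigma>_def nth_append less_Suc_eq)
  qed (use n in \<open>auto simp: \<sigma>_def\<close>)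
  ultimately show thesis
    using that by blast
qed

lemma A2_no_fsigma_colouring:
  fixes c :: "(nat \<Rightarrow> bool) \<Rightarrow> nat"
  assumes "\<And>k. fsigma_in Cantor_space {\<alpha>. c \<alpha> = k}"
  obtains \<alpha> \<beta> where "(\<alpha>, \<beta>) \<in> A2" "c \<alpha> = c \<beta>"
proof -
  have "\<forall>k. \<exists>\<F>. countable \<F> \<and> \<F> \<subseteq> Collect (closedin Cantor_space) \<and> \<Union>\<F> = {\<alpha>. c \<alpha> = k}"
    using assms by (auto simp: fsigma_in_def union_of_def)
  then obtain \<F> where \<F>: "\<And>k. countable (\<F> k)" "\<And>k. \<F> k \<subseteq> Collect (closedin Cantor_space)"
      "\<And>k. \<Union>(\<F> k) = {\<alpha>. c \<alpha> = k}"
    by metis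
  \<comment> \<open>The closed pieces of all colour classes form one countable cover; a piece
    containing a cylinder lies in a single class.\<close>
  obtain T \<alpha> L where T: "T \<in> (\<Union>k. \<F> k)" "\<And>\<beta>. (\<forall>j<L. \<beta> j = \<alpha> j) \<Longrightarrow> \<beta> \<in> T"
  proof (rule Cantor_space_Baire[of "\<Union>k. \<F> k"])
    show "\<Union>(\<Union>k. \<F> k) = UNIV"
      using \<F>(3) by (force simp: set_eq_iff)
    show "closedin Cantor_space T" if "T \<in> (\<Union>k. \<F> k)" for T
      using that \<F>(2) by blast
  qed (use \<F>(1) in auto)
  obtain k where "T \<subseteq> {\<alpha>. c \<alpha> = k}"
    using T(1) \<F>(3) by blast
  moreover obtain \<beta> \<gamma> where "(\<beta>, \<gamma>) \<in> A2" "\<forall>j<L. \<beta> j = \<alpha> j" "\<forall>j<L. \<gamma> j = \<alpha> j"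
    by (rule A2_meets_cylinder)
  ultimately show thesis
    using T(2) that[of \<beta> \<gamma>] by (metis (mono_tags, lifting) mem_Collect_eq subsetD)
qed

lemma fsigma_in_continuous_map_preimage:
  assumes "continuous_map X Y f" "fsigma_in Y S"
  shows "fsigma_in X {x \<in> topspace X. f x \<in> S}"
proof -
  obtain \<F> where \<F>: "countable \<F>" "\<F> \<subseteq> Collect (closedin Y)" "\<Union>\<F> = S"
    using assms(2) by (auto simp: fsigma_in_def union_of_def)
  have "{x \<in> topspace X. f x \<in> S} = \<Union>((\<lambda>C. {x \<in> topspace X. f x \<in> C}) ` \<F>)"
    using \<F>(3) by blast
  moreover have "fsigma_in X \<dots>"
    using \<F>(1,2) assms(1) closedin_continuous_map_preimage
    by (intro fsigma_in_Union) (blast intro: closed_imp_fsigma_in)+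
  ultimately show ?thesis
    by simp
qed

section \<open>Homomorphisms from shrinking balls\<close>

text \<open>Position 0 is skipped, as in the \<open>shift\<close> of \<open>A2\<close>: it selects
  the next centre, while the place of the first later one controls the radius.\<close>

definition first_one :: "(nat \<Rightarrow> bool) \<Rightarrow> nat option" where
  "first_one \<sigma> = (if \<exists>j. \<sigma> (Suc j) then Some (LEAST j. \<sigma> (Suc j)) else None)"

lemma first_one_eq_None: "first_one \<sigma> = None \<longleftrightarrow> (\<forall>j. \<not> \<sigma> (Suc j))"
  by (simp add: first_one_def)

lemma first_one_eq_Some: "first_one \<sigma> = Some k \<longleftrightarrow> \<sigma> (Suc k) \<and> (\<forall>j<k. \<not> \<sigma> (Suc j))"
proof
  assume "first_one \<sigma> = Some k"
  then have "\<exists>j. \<sigma> (Suc j)" "k = (LEAST j. \<sigma> (Suc j))"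
    by (auto simp: first_one_def split: if_splits)
  then show "\<sigma> (Suc k) \<and> (\<forall>j<k. \<not> \<sigma> (Suc j))"
    by (metis LeastI not_less_Least)
next
  assume "\<sigma> (Suc k) \<and> (\<forall>j<k. \<not> \<sigma> (Suc j))"
  then show "first_one \<sigma> = Some k"
    by (auto simp: first_one_def intro!: Least_equality leI)
qed

text \<open>The factor 2 turns a bound on radii into one on diameters.\<close>

lemma half_power_less:
  assumes "0 < (e::real)"
  obtains n where "2 * (1/2) ^ n < e"
proof -
  obtain n where "(1/2) ^ n < e / 2"
    using real_arch_pow_inv[of "e/2" "1/2"] assms by auto
  then show thesis
    using that[of n] by simp
qed

text \<open>\<open>pick False c r\<close> and \<open>pick True c r\<close> stand for the coordinates
  of a pair of the relation chosen inside the ball; the relation itself enters in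
  \<open>A2_homomorphism\<close>.\<close>

locale ball_scheme = Metric_space M d for M :: "'a set" and d +
  fixes pick :: "bool \<Rightarrow> 'a \<Rightarrow> real \<Rightarrow> 'a" and x0 :: 'a
  assumes complete: mcomplete
    and x0_in: "x0 \<in> M"
    and pick_in: "\<And>b c r. \<lbrakk>c \<in> M; 0 < r\<rbrakk> \<Longrightarrow> pick b c r \<in> mball c r"
begin

text \<open>Section \<open>n\<close> of \<open>\<alpha>\<close> is either \<open>\<epsilon>0\<^sup>\<infinity>\<close> or begins with \<open>\<epsilon>0\<^sup>k1\<close>.  The centre of the next ball
  depends on \<open>\<epsilon>\<close> only, and its radius tends to 0 as \<open>k\<close> grows.  Radius 0 means that a section
  \<open>\<epsilon>0\<^sup>\<infinity>\<close> has occurred, after which nothing changes.\<close>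

primrec stage :: "(nat \<Rightarrow> bool) \<Rightarrow> nat \<Rightarrow> 'a \<times> real" where
  "stage \<alpha> 0 = (x0, 1)"
| "stage \<alpha> (Suc n) = (let (c, r) = stage \<alpha> n; y = pick (section_of \<alpha> n 0) c r in
     if r = 0 then (c, 0)
     else (y, case first_one (section_of \<alpha> n) of
                None \<Rightarrow> 0
              | Some k \<Rightarrow> min ((r - d c y) / 2) (1 / real (Suc k))))"

abbreviation "centre \<alpha> n \<equiv> fst (stage \<alpha> n)"
abbreviation "radius \<alpha> n \<equiv> snd (stage \<alpha> n)"

lemma stage_Suc_stopped: "radius \<alpha> n = 0 \<Longrightarrow> stage \<alpha> (Suc n) = stage \<alpha> n"
  by (simp add: split_beta Let_def prod_eq_iff)

lemma stage_Suc:
  assumes "radius \<alpha> n \<noteq> 0"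
  shows "centre \<alpha> (Suc n) = pick (section_of \<alpha> n 0) (centre \<alpha> n) (radius \<alpha> n)"
    and "radius \<alpha> (Suc n) = (case first_one (section_of \<alpha> n) of None \<Rightarrow> 0
          | Some k \<Rightarrow> min ((radius \<alpha> n - d (centre \<alpha> n) (centre \<alpha> (Suc n))) / 2) (1 / real (Suc k)))"
  using assms by (simp_all add: split_beta Let_def split: option.split)

declare stage.simps(2) [simp del]

section \<open>Nested balls with shrinking radii\<close>

lemma stage_in: "centre \<alpha> n \<in> M \<and> 0 \<le> radius \<alpha> n"
proof (induction n)
  case (Suc n)
  show ?case
  proof (cases "radius \<alpha> n = 0")
    case False
    then have "pick (section_of \<alpha> n 0) (centre \<alpha> n) (radius \<alpha> n) \<in> mball (centre \<alpha> n) (radius \<alpha> n)"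
      using Suc by (intro pick_in) auto
    then show ?thesis
      using False by (auto simp: stage_Suc split: option.splits)
  qed (use Suc in \<open>simp add: stage_Suc_stopped\<close>)
qed (simp add: x0_in)

lemma centre_in [simp]: "centre \<alpha> n \<in> M" and radius_nonneg [simp]: "0 \<le> radius \<alpha> n"
  using stage_in by auto

lemma centre_Suc_in_mball:
  assumes "0 < radius \<alpha> n"
  shows "d (centre \<alpha> n) (centre \<alpha> (Suc n)) < radius \<alpha> n"
  using assms pick_in[OF centre_in assms, of "section_of \<alpha> n 0"] by (simp add: stage_Suc)

text \<open>The picked point lies strictly inside the ball, so both terms of the minimum are
  positive.\<close>

lemma radius_Suc_pos:
  assumes "0 < radius \<alpha> n" "first_one (section_of \<alpha> n) \<noteq> None"
  shows "0 < radius \<alpha> (Suc n)"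
  using assms centre_Suc_in_mball by (auto simp: stage_Suc(2))

lemma radius_Suc_le:
  assumes "0 < radius \<alpha> n"
  shows "radius \<alpha> (Suc n) \<le> (radius \<alpha> n - d (centre \<alpha> n) (centre \<alpha> (Suc n))) / 2"
proof -
  define x where "x = (radius \<alpha> n - d (centre \<alpha> n) (centre \<alpha> (Suc n))) / 2"
  have "0 \<le> x"
    using centre_Suc_in_mball[OF assms] by (simp add: x_def)
  then have "radius \<alpha> (Suc n) \<le> x"
    using assms by (simp add: stage_Suc(2) flip: x_def split: option.split)
  then show ?thesis
    by (simp only: x_def)
qed

text \<open>Nesting of consecutive balls in metric form: the new radius is at most half of what the
  move of the centre leaves of the old one.\<close>

lemma stage_step: "d (centre \<alpha> n) (centre \<alpha> (Suc n)) + radius \<alpha> (Suc n) \<le> radius \<alpha> n"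
proof (cases "radius \<alpha> n = 0")
  case False
  then have "d (centre \<alpha> n) (centre \<alpha> (Suc n)) < radius \<alpha> n"
    by (intro centre_Suc_in_mball) (simp add: order_less_le)
  moreover have "radius \<alpha> (Suc n) \<le> (radius \<alpha> n - d (centre \<alpha> n) (centre \<alpha> (Suc n))) / 2"
    using False by (intro radius_Suc_le) (simp add: order_less_le)
  ultimately show ?thesis
    by (simp add: field_simps)
qed (simp add: stage_Suc_stopped)

lemma radius_le: "radius \<alpha> n \<le> (1/2) ^ n"
proof (induction n)
  case (Suc n)
  have "radius \<alpha> (Suc n) \<le> radius \<alpha> n / 2"
  proof (cases "radius \<alpha> n = 0")
    case False
    then have "radius \<alpha> (Suc n) \<le> (radius \<alpha> n - d (centre \<alpha> n) (centre \<alpha> (Suc n))) / 2"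
      by (intro radius_Suc_le) (simp add: order_less_le)
    then show ?thesis
      by (rule order_trans) simp
  qed (simp add: stage_Suc_stopped)
  then show ?case
    using Suc by simp
qed simp

lemma mcball_stage_antimono:
  assumes "n \<le> m"
  shows "mcball (centre \<alpha> m) (radius \<alpha> m) \<subseteq> mcball (centre \<alpha> n) (radius \<alpha> n)"
  using assms
proof (induction rule: dec_induct)
  case (step m)
  have "mcball (centre \<alpha> (Suc m)) (radius \<alpha> (Suc m)) \<subseteq> mcball (centre \<alpha> m) (radius \<alpha> m)"
    using stage_step by (intro mcball_subset) (simp_all add: commute)
  with step show ?case
    by blast
qed simp

lemma centre_in_mcball: "n \<le> m \<Longrightarrow> centre \<alpha> m \<in> mcball (centre \<alpha> n) (radius \<alpha> n)"
  using mcball_stage_antimono[of n m \<alpha>] by (meson centre_in centre_in_mcball_iff radius_nonneg subsetD)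

section \<open>Limits of the centres and their continuity\<close>

lemma dist_mcball:
  assumes "x \<in> mcball c r" "y \<in> mcball c r"
  shows "d x y \<le> 2 * r"
  using assms triangle[of x c y] by (auto simp: commute)

lemma MCauchy_centre: "MCauchy (centre \<alpha>)"
  unfolding MCauchy_def
proof (intro conjI allI impI)
  fix e :: real assume "e > 0"
  then obtain N where N: "2 * (1/2) ^ N < e"
    by (rule half_power_less)
  have "d (centre \<alpha> n) (centre \<alpha> n') < e" if "N \<le> n" "N \<le> n'" for n n'
    using dist_mcball[OF centre_in_mcball[OF that(1), of \<alpha>] centre_in_mcball[OF that(2), of \<alpha>]]
      radius_le[of \<alpha> N] N by simp
  then show "\<exists>N. \<forall>n n'. N \<le> n \<longrightarrow> N \<le> n' \<longrightarrow> d (centre \<alpha> n) (centre \<alpha> n') < e"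
    by blast
qed auto

definition limit_point :: "(nat \<Rightarrow> bool) \<Rightarrow> 'a" where
  "limit_point \<alpha> = (SOME x. limitin mtopology (centre \<alpha>) x sequentially)"

lemma limitin_limit_point: "limitin mtopology (centre \<alpha>) (limit_point \<alpha>) sequentially"
  using complete MCauchy_centre unfolding limit_point_def mcomplete_def by (metis someI_ex)

lemma limit_point_in_mcball: "limit_point \<alpha> \<in> mcball (centre \<alpha> n) (radius \<alpha> n)"
  by (rule limitin_closedin[OF limitin_limit_point closedin_mcball])
    (auto simp del: in_mcball intro!: eventually_sequentiallyI[of n] centre_in_mcball)

lemma limit_point_in [simp]: "limit_point \<alpha> \<in> M"
  using limit_point_in_mcball by (meson in_mcball)

text \<open>A closed ball of radius 0 is a single point.\<close>

lemma limit_point_stopped: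
  assumes "radius \<alpha> n = 0"
  shows "limit_point \<alpha> = centre \<alpha> n"
  using limit_point_in_mcball[of \<alpha> n] assms nonneg[of "centre \<alpha> n" "limit_point \<alpha>"]
    zero[OF centre_in limit_point_in, of \<alpha> n \<alpha>] by auto

lemma limit_point_None:
  assumes "stage \<alpha> n = (c, r)" "0 < r" "first_one (section_of \<alpha> n) = None"
  shows "limit_point \<alpha> = pick (section_of \<alpha> n 0) c r"
  using limit_point_stopped[of \<alpha> "Suc n"] assms by (simp add: stage_Suc)

text \<open>A stage of positive radius depends on finitely many coordinates. Once \<alpha> has
  stopped, a nearby \<beta> may still go on because of a late one, but then in a small ball; the sum
  bounds the distance from the centre of \<alpha> to all points of that ball.\<close>

lemma stage_continuous:
  assumes "0 < e"
  shows "\<exists>L. \<forall>\<beta>. (\<forall>j<L. \<beta> j = \<alpha> j) \<longrightarrow>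
    stage \<beta> n = stage \<alpha> n \<or>
    radius \<alpha> n = 0 \<and> d (centre \<alpha> n) (centre \<beta> n) + radius \<beta> n < e"
proof (induction n)
  case (Suc n)
  then obtain L where L: "\<And>\<beta>. \<forall>j<L. \<beta> j = \<alpha> j \<Longrightarrow> stage \<beta> n = stage \<alpha> n \<or>
      radius \<alpha> n = 0 \<and> d (centre \<alpha> n) (centre \<beta> n) + radius \<beta> n < e"
    by blast
  show ?case
  proof (cases "radius \<alpha> n = 0")
    case True
    \<comment> \<open>By \<open>stage_step\<close> and the triangle inequality, the sum does not
      grow while \<alpha> rests.\<close>
    have "stage \<beta> (Suc n) = stage \<alpha> (Suc n) \<or> radius \<alpha> (Suc n) = 0 \<and>
        d (centre \<alpha> (Suc n)) (centre \<beta> (Suc n)) + radius \<beta> (Suc n) < e"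
      if "\<forall>j<L. \<beta> j = \<alpha> j" for \<beta>
      using L[OF that] True stage_step[of \<beta> n] triangle[of "centre \<alpha> n" "centre \<beta> n" "centre \<beta> (Suc n)"]
      by (auto simp: stage_Suc_stopped)
    then show ?thesis
      by blast
  next
    case False
    let ?\<sigma> = "\<lambda>\<beta>. section_of \<beta> n"
    \<comment> \<open>Positions up to \<open>Suc K\<close> show the first one of \<alpha>, if there
      is one. Otherwise they force the first one of \<beta> to come so late that
      \<open>1 / real (Suc k) < e\<close>.\<close>
    define K where "K = (case first_one (?\<sigma> \<alpha>) of Some k \<Rightarrow> k | None \<Rightarrow> nat \<lceil>1 / e\<rceil>)"
    \<comment> \<open>Agreement below \<open>L'\<close> controls stage \<open>n\<close> and fixes
      positions 0 to \<open>Suc K\<close> of section \<open>n\<close>.\<close>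
    define L' where "L' = max L (Suc (Max (pair_code n ` {..Suc K})))"
    have "stage \<beta> (Suc n) = stage \<alpha> (Suc n) \<or> radius \<alpha> (Suc n) = 0 \<and>
        d (centre \<alpha> (Suc n)) (centre \<beta> (Suc n)) + radius \<beta> (Suc n) < e"
      if \<beta>: "\<forall>j<L'. \<beta> j = \<alpha> j" for \<beta>
    proof -
      have eq: "stage \<beta> n = stage \<alpha> n"
        using L[of \<beta>] \<beta> False by (auto simp: L'_def)
      have \<sigma>: "?\<sigma> \<beta> p = ?\<sigma> \<alpha> p" if "p \<le> Suc K" for p
      proof -
        have "pair_code n p \<le> Max (pair_code n ` {..Suc K})"
          using that by (intro Max_ge) auto
        then show ?thesis
          using \<beta> by (simp add: section_of_def L'_def)
      qed
      have centre_eq: "centre \<beta> (Suc n) = centre \<alpha> (Suc n)"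
        using False eq \<sigma>[of 0] by (simp add: stage_Suc)
      show ?thesis
      proof (cases "first_one (?\<sigma> \<alpha>)")
        case (Some k)
        then have "first_one (?\<sigma> \<beta>) = Some k"
          using \<sigma> by (simp add: first_one_eq_Some K_def[unfolded Some option.case])
        then show ?thesis
          using False eq centre_eq Some by (simp add: prod_eq_iff stage_Suc(2))
      next
        case None
        then have K: "K = nat \<lceil>1 / e\<rceil>"
          by (simp add: K_def)
        have "radius \<beta> (Suc n) < e"
        proof (cases "first_one (?\<sigma> \<beta>)")
          case None
          then show ?thesis
            using assms False eq by (simp add: stage_Suc(2))
        next
          case (Some k)
          have "K < k"
          proof (rule ccontr)
            assume "\<not> K < k"
            then have "?\<sigma> \<alpha> (Suc k)"
              using \<sigma>[of "Suc k"] Some by (simp add: first_one_eq_Some)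
            then show False
              using None by (simp add: first_one_eq_None)
          qed
          then have "1 / e < real (Suc k)"
            using K by linarith
          then have "1 / real (Suc k) < e"
            using assms by (simp add: field_simps)
          moreover have "radius \<beta> (Suc n) \<le> 1 / real (Suc k)"
            using Some False eq by (simp add: stage_Suc(2))
          ultimately show ?thesis
            by linarith
        qed
        moreover have "radius \<alpha> (Suc n) = 0"
          using None False by (simp add: stage_Suc(2))
        ultimately show ?thesis
          using centre_eq by simp
      qed
    qed
    then show ?thesis
      by blast
  qed
qed simp

text \<open>Either both limits lie in a common ball of diameter below \<open>e\<close>, or \<alpha>
  has reached its limit and the limit of \<beta> is in a small ball nearby.\<close>

lemma continuous_map_limit_point: "continuous_map Cantor_space mtopology limit_point"
  unfolding continuous_map_to_metric
proof (intro ballI allI impI)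
  fix \<alpha> and e :: real assume "0 < e"
  then obtain n where n: "2 * (1/2) ^ n < e"
    by (rule half_power_less)
  obtain L where L: "\<And>\<beta>. \<forall>j<L. \<beta> j = \<alpha> j \<Longrightarrow> stage \<beta> n = stage \<alpha> n \<or>
      radius \<alpha> n = 0 \<and> d (centre \<alpha> n) (centre \<beta> n) + radius \<beta> n < e"
    using stage_continuous[OF \<open>0 < e\<close>] by blast
  have "d (limit_point \<alpha>) (limit_point \<beta>) < e" if "\<forall>j<L. \<beta> j = \<alpha> j" for \<beta>
    using L[OF that]
  proof
    assume "stage \<beta> n = stage \<alpha> n"
    then show ?thesis
      using dist_mcball[OF limit_point_in_mcball[of \<alpha> n], of "limit_point \<beta>"]
        limit_point_in_mcball[of \<beta> n] radius_le[of \<alpha> n] n by simp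
  next
    assume *: "radius \<alpha> n = 0 \<and> d (centre \<alpha> n) (centre \<beta> n) + radius \<beta> n < e"
    then show ?thesis
      using limit_point_stopped[of \<alpha> n] limit_point_in_mcball[of \<beta> n]
        triangle[of "centre \<alpha> n" "centre \<beta> n" "limit_point \<beta>"] by simp
  qed
  moreover have "openin Cantor_space {\<beta>. \<forall>j<L. \<beta> j = \<alpha> j}"
    by (auto simp: openin_Cantor_space)
  ultimately show "\<exists>U. openin Cantor_space U \<and> \<alpha> \<in> U \<and> (\<forall>\<beta>\<in>U. limit_point \<beta> \<in> mball (limit_point \<alpha>) e)"
    by (intro exI[of _ "{\<beta>. \<forall>j<L. \<beta> j = \<alpha> j}"]) simp
qed

lemma stage_cong:
  assumes "\<And>i. i < n \<Longrightarrow> section_of \<alpha> i = section_of \<beta> i"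
  shows "stage \<alpha> n = stage \<beta> n"
  using assms
proof (induction n)
  case (Suc n)
  then have "stage \<alpha> n = stage \<beta> n" "section_of \<alpha> n = section_of \<beta> n"
    by auto
  then show ?case
    by (simp only: stage.simps(2))
qed simp

text \<open>Sections before \<open>n\<close> agree and each has a one after position 0, so both
  sequences reach the same ball of positive radius. Section \<open>n\<close> then stops them at the
  two picks in this ball.\<close>

lemma limit_point_A2:
  assumes "(\<alpha>, \<beta>) \<in> A2"
  obtains c r where "c \<in> M" "0 < r" "limit_point \<alpha> = pick False c r" "limit_point \<beta> = pick True c r"
proof -
  obtain n where n: "\<And>i. i < n \<Longrightarrow> section_of \<alpha> i = section_of \<beta> i"
      "\<And>i. i < n \<Longrightarrow> initial_segment (replicate (t_seq n ! i) False @ [True]) (shift (section_of \<alpha> i))"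
      "section_of \<alpha> n = (\<lambda>p. False)" "section_of \<beta> n = (\<lambda>p. p = 0)"
    using assms unfolding A2_def by blast
  have "section_of \<alpha> i (Suc (t_seq n ! i))" if "i < n" for i
    using n(2)[OF that] unfolding initial_segment_def shift_def
    by (auto dest: spec[of _ "t_seq n ! i"] simp: nth_append)
  then have "first_one (section_of \<alpha> i) \<noteq> None" if "i < n" for i
    using that first_one_eq_None by blast
  then have "0 < radius \<alpha> n"
    by (induction n) (auto intro: radius_Suc_pos)
  moreover have "stage \<beta> n = stage \<alpha> n"
    using n(1) by (metis stage_cong)
  ultimately show thesis
    using limit_point_None[of \<alpha> n "centre \<alpha> n" "radius \<alpha> n"] n(3,4)
      limit_point_None[of \<beta> n "centre \<alpha> n" "radius \<alpha> n"]
    by (intro that[of "centre \<alpha> n" "radius \<alpha> n"]) (simp_all add: first_one_eq_None)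
qed

end

lemma A2_homomorphism:
  assumes "completely_metrizable_space Y" "topspace Y \<noteq> {}"
    and meets: "\<And>V. \<lbrakk>openin Y V; V \<noteq> {}\<rbrakk> \<Longrightarrow> A \<inter> V \<times> V \<noteq> {}"
  obtains f where "continuous_map Cantor_space Y f" "\<And>\<alpha> \<beta>. (\<alpha>, \<beta>) \<in> A2 \<Longrightarrow> (f \<alpha>, f \<beta>) \<in> A"
proof -
  obtain M d where "Metric_space M d" and complete: "Metric_space.mcomplete M d"
      and Y: "Y = Metric_space.mtopology M d"
    using assms(1) by (auto simp: completely_metrizable_space_def)
  then interpret Metric_space M d
    by simp
  \<comment> \<open>Every ball is a nonempty open set, so \<open>p\<close> below can choose a pair
    of \<open>A\<close> in it; its coordinates serve as picks.\<close>
  have "A \<inter> mball c r \<times> mball c r \<noteq> {}" if "c \<in> M" "0 < r" for c r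
    using that by (intro meets) (auto simp: Y mball_eq_empty)
  then have "\<forall>c r. \<exists>q. c \<in> M \<and> 0 < r \<longrightarrow> q \<in> A \<inter> mball c r \<times> mball c r"
    by (meson ex_in_conv)
  then obtain p where p: "\<And>c r. \<lbrakk>c \<in> M; 0 < r\<rbrakk> \<Longrightarrow> p c r \<in> A \<inter> mball c r \<times> mball c r"
    by metis
  obtain x0 where "x0 \<in> M"
    using assms(2) Y by auto
  interpret ball_scheme M d "\<lambda>b c r. (if b then snd else fst) (p c r)" x0
  proof
    show "(if b then snd else fst) (p c r) \<in> mball c r" if "c \<in> M" "0 < r" for b c r
      using p[OF that] by (auto simp: mem_Times_iff simp del: in_mball)
  qed (use complete \<open>x0 \<in> M\<close> in auto)
  show thesis
  proof
    show "continuous_map Cantor_space Y limit_point"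
      using continuous_map_limit_point by (simp add: Y)
    show "(limit_point \<alpha>, limit_point \<beta>) \<in> A" if "(\<alpha>, \<beta>) \<in> A2" for \<alpha> \<beta>
      using limit_point_A2[OF that] p by (metis (no_types, lifting) IntD1 prod.collapse)
  qed
qed

section \<open>Countable covers by closed discrete sets\<close>

text \<open>Membership in the sigma-ideal generated by the closed sets that are independent for
  \<open>A\<close>; \<open>discrete\<close> means that no pair of \<open>A\<close> has both
  coordinates in \<open>C\<close>.\<close>

definition closed_discrete_coverable :: "'a topology \<Rightarrow> ('a \<times> 'a) set \<Rightarrow> 'a set \<Rightarrow> bool" where
  "closed_discrete_coverable X A S \<longleftrightarrow>
     (\<exists>\<C>. countable \<C> \<and> (\<forall>C\<in>\<C>. closedin X C \<and> A \<inter> C \<times> C = {}) \<and> S \<subseteq> \<Union>\<C>)"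

lemma closed_discrete_coverable_Union:
  assumes "countable \<S>" "\<And>S. S \<in> \<S> \<Longrightarrow> closed_discrete_coverable X A S"
  shows "closed_discrete_coverable X A (\<Union>\<S>)"
proof -
  have "\<forall>S\<in>\<S>. \<exists>\<C>. countable \<C> \<and> (\<forall>C\<in>\<C>. closedin X C \<and> A \<inter> C \<times> C = {}) \<and> S \<subseteq> \<Union>\<C>"
    using assms(2) by (simp add: closed_discrete_coverable_def)
  then obtain \<C> where \<C>: "\<forall>S\<in>\<S>. countable (\<C> S) \<and>
      (\<forall>C\<in>\<C> S. closedin X C \<and> A \<inter> C \<times> C = {}) \<and> S \<subseteq> \<Union>(\<C> S)"
    by (rule bchoice[THEN exE])
  show ?thesis
    unfolding closed_discrete_coverable_def
  proof (intro exI conjI)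
    show "countable (\<Union>S\<in>\<S>. \<C> S)"
      using \<C> assms(1) by blast
    show "\<forall>C\<in>\<Union>S\<in>\<S>. \<C> S. closedin X C \<and> A \<inter> C \<times> C = {}"
      using \<C> by simp
    show "\<Union>\<S> \<subseteq> \<Union>(\<Union>S\<in>\<S>. \<C> S)"
    proof (rule Union_least)
      fix S assume "S \<in> \<S>"
      then have "S \<subseteq> \<Union>(\<C> S)" "\<C> S \<subseteq> (\<Union>S\<in>\<S>. \<C> S)"
        using \<C> by (simp, blast)
      then show "S \<subseteq> \<Union>(\<Union>S\<in>\<S>. \<C> S)"
        by blast
    qed
  qed
qed

lemma closed_discrete_coverable_subset:
  "\<lbrakk>closed_discrete_coverable X A T; S \<subseteq> T\<rbrakk> \<Longrightarrow> closed_discrete_coverable X A S"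
  unfolding closed_discrete_coverable_def by (meson order_trans)

lemma closed_discrete_coverable_fsigma:
  assumes "fsigma_in X S" "A \<inter> S \<times> S = {}"
  shows "closed_discrete_coverable X A S"
proof -
  obtain \<F> where "countable \<F>" "\<F> \<subseteq> Collect (closedin X)" "\<Union>\<F> = S"
    using assms(1) by (auto simp: fsigma_in_def union_of_def)
  moreover have "A \<inter> C \<times> C = {}" if "C \<in> \<F>" for C
  proof -
    have "C \<subseteq> S"
      using that \<open>\<Union>\<F> = S\<close> by blast
    then have "C \<times> C \<subseteq> S \<times> S"
      by (simp add: Sigma_mono)
    then show ?thesis
      using assms(2) by blast
  qed
  ultimately show ?thesis
    unfolding closed_discrete_coverable_def by (intro exI[of _ \<F>]) auto
qed

text \<open>Each point is coloured by the first closed set containing it. Colour classes are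
  differences of closed sets, and closed sets are both F-sigma and G-delta in a metrizable
  space.\<close>

lemma closed_discrete_coverable_imp_colouring:
  assumes "metrizable_space X" "A \<subseteq> topspace X \<times> topspace X"
    and "closed_discrete_coverable X A (topspace X)"
  obtains c where "Delta02_measurable X c" "\<And>x y. (x, y) \<in> A \<Longrightarrow> c x \<noteq> c y"
proof -
  obtain \<C> where \<C>: "countable \<C>" "\<And>C. C \<in> \<C> \<Longrightarrow> closedin X C \<and> A \<inter> C \<times> C = {}"
      "topspace X \<subseteq> \<Union>\<C>"
    using assms(3) unfolding closed_discrete_coverable_def by blast
  \<comment> \<open>Inserting \<open>{}\<close> ensures that there is a set to enumerate.\<close>
  define F where "F = from_nat_into (insert {} \<C>)"
  have F: "closedin X (F k)" "A \<inter> F k \<times> F k = {}" for k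
    using from_nat_into[of "insert {} \<C>" k] \<C>(2) by (auto simp: F_def)
  have cover: "\<exists>k. x \<in> F k" if x: "x \<in> topspace X" for x
  proof -
    obtain C where "C \<in> \<C>" "x \<in> C"
      using \<C>(3) x by blast
    moreover obtain k where "F k = C"
      using \<open>C \<in> \<C>\<close> \<C>(1) from_nat_into_surj[of "insert {} \<C>" C] by (auto simp: F_def)
    ultimately show ?thesis
      by blast
  qed
  define c where "c x = (LEAST k. x \<in> F k)" for x
  have c: "x \<in> F (c x)" "k < c x \<Longrightarrow> x \<notin> F k" if "x \<in> topspace X" for x k
    using cover[OF that] unfolding c_def by (auto intro: LeastI dest: not_less_Least)
  show thesis
  proof
    show "Delta02_measurable X c"
      unfolding Delta02_measurable_def Delta02_in_def
    proof
      fix k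
      have "{x \<in> topspace X. c x = k} = F k - (\<Union>j<k. F j)"
      proof (intro set_eqI iffI)
        fix x assume "x \<in> F k - (\<Union>j<k. F j)"
        then have "x \<in> F k" "\<And>j. j < k \<Longrightarrow> x \<notin> F j" and x: "x \<in> topspace X"
          using F(1) closedin_subset by blast+
        then have "c x = k"
          using c[OF x] by (metis linorder_neqE_nat)
        with x show "x \<in> {x \<in> topspace X. c x = k}"
          by simp
      qed (use c in auto)
      moreover have "closedin X (F k)" "closedin X (\<Union>j<k. F j)"
        using F(1) by (auto intro!: closedin_Union)
      ultimately show "fsigma_in X {x \<in> topspace X. c x = k} \<and> gdelta_in X {x \<in> topspace X. c x = k}"
        using assms(1) by (simp add: fsigma_in_diff gdelta_in_diff closed_imp_fsigma_in closed_imp_gdelta_in)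
    qed
    show "c x \<noteq> c y" if "(x, y) \<in> A" for x y
    proof
      assume "c x = c y"
      then have "(x, y) \<in> F (c x) \<times> F (c x)"
        using c(1)[of x] c(1)[of y] assms(2) that by auto
      then show False
        using F(2) that by blast
    qed
  qed
qed

text \<open>The balls of radius \<open>1 / real (Suc k)\<close> around the points of a countable
  dense set form a base.\<close>

lemma metrizable_separable_imp_second_countable:
  assumes "metrizable_space X" "separable_space X"
  shows "second_countable X"
proof -
  obtain M d where "Metric_space M d" and X: "X = Metric_space.mtopology M d"
    using assms(1) by (auto simp: metrizable_space_def)
  then interpret Metric_space M d
    by simp
  obtain C where C: "countable C" "C \<subseteq> M" "mtopology closure_of C = M"
    using assms(2) by (auto simp: separable_space_def X)
  define \<B> where "\<B> = (\<lambda>(c, k). mball c (1 / real (Suc k))) ` (C \<times> (UNIV :: nat set))"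
  have "\<exists>V\<in>\<B>. x \<in> V \<and> V \<subseteq> U" if U: "openin mtopology U" and "x \<in> U" for U x
  proof -
    have x: "x \<in> M"
      using openin_subset[OF U] \<open>x \<in> U\<close> by auto
    obtain e where e: "0 < e" "mball x e \<subseteq> U"
      using U \<open>x \<in> U\<close> unfolding openin_mtopology by blast
    \<comment> \<open>Half of \<open>e\<close>: a ball of this radius whose centre is this close to
      \<open>x\<close> stays inside \<open>mball x e\<close>.\<close>
    obtain k where k: "1 / real (Suc k) < e / 2"
      using e(1) nat_approx_posE[of "e/2"] by auto
    have "x \<in> mtopology closure_of C"
      using C(3) x by simp
    then have "\<forall>r>0. \<exists>c\<in>C. c \<in> mball x r"
      by (simp add: metric_closure_of del: in_mball)
    moreover have "0 < 1 / real (Suc k)"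
      by simp
    ultimately obtain c where c: "c \<in> C" "c \<in> mball x (1 / real (Suc k))"
      by blast
    have "mball c (1 / real (Suc k)) \<subseteq> mball x e"
      using c k mball_subset[of c x "1 / real (Suc k)" e] by (simp add: commute)
    moreover have "x \<in> mball c (1 / real (Suc k))"
      using c by (simp add: commute)
    moreover have "mball c (1 / real (Suc k)) \<in> \<B>"
      using c(1) by (auto simp: \<B>_def simp del: of_nat_Suc)
    ultimately show ?thesis
      using e(2) by (meson order_trans)
  qed
  moreover have "countable \<B>" "\<forall>V\<in>\<B>. openin mtopology V"
    using C(1) by (auto simp: \<B>_def)
  ultimately show ?thesis
    unfolding second_countable_def X by blast
qed

lemma colouring_or_homomorphism:
  assumes "Polish_topology X" "A \<subseteq> topspace X \<times> topspace X"
    and no_colouring: "\<not> closed_discrete_coverable X A (topspace X)"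
  obtains f where "continuous_map Cantor_space X f" "\<And>\<alpha> \<beta>. (\<alpha>, \<beta>) \<in> A2 \<Longrightarrow> (f \<alpha>, f \<beta>) \<in> A"
proof -
  have X: "completely_metrizable_space X" "metrizable_space X" "second_countable X"
    using assms(1) metrizable_separable_imp_second_countable[of X]
    by (simp_all add: Polish_topology_def completely_metrizable_imp_metrizable_space)
  obtain \<B> where \<B>: "countable \<B>" "\<forall>V\<in>\<B>. openin X V"
      "\<forall>U x. openin X U \<and> x \<in> U \<longrightarrow> (\<exists>V\<in>\<B>. x \<in> V \<and> V \<subseteq> U)"
    using X(3) unfolding second_countable_def by (elim exE conjE)
  \<comment> \<open>Countability of the base makes \<open>W\<close> itself coverable; it is the
    largest coverable open set.\<close>
  define W where "W = \<Union>{V \<in> \<B>. closed_discrete_coverable X A V}"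
  have W: "closed_discrete_coverable X A W"
    unfolding W_def using \<B>(1) by (intro closed_discrete_coverable_Union) auto
  have "openin X W"
    unfolding W_def using \<B>(2) by blast
  define Y where "Y = topspace X - W"
  have "closedin X Y"
    using \<open>openin X W\<close> by (simp add: Y_def closedin_diff)
  have "Y \<noteq> {}"
    using no_colouring closed_discrete_coverable_subset[OF W] by (auto simp: Y_def)
  have meets: "A \<inter> V \<times> V \<noteq> {}" if V: "openin (subtopology X Y) V" "V \<noteq> {}" for V
  proof
    assume discrete: "A \<inter> V \<times> V = {}"
    obtain U where U: "openin X U" "V = U \<inter> Y"
      using V(1) by (auto simp: openin_subtopology)
    \<comment> \<open>\<open>V\<close> is the intersection of an open and a closed set, and open
      sets of a metrizable space are F-sigma.\<close>
    have "fsigma_in X V"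
      unfolding U(2) using U(1) \<open>closedin X Y\<close> X(2)
      by (intro fsigma_in_Int open_imp_fsigma_in closed_imp_fsigma_in)
    then have "closed_discrete_coverable X A V"
      using discrete by (rule closed_discrete_coverable_fsigma)
    then have "closed_discrete_coverable X A (\<Union>{V, W})"
      using W by (intro closed_discrete_coverable_Union) auto
    \<comment> \<open>Hence \<open>U\<close> is coverable, so every basic open subset of
      \<open>U\<close> lies in \<open>W\<close>, although \<open>U\<close> meets
      \<open>Y\<close>.\<close>
    moreover have "U \<subseteq> \<Union>{V, W}"
      using openin_subset[OF U(1)] by (auto simp: U(2) Y_def)
    ultimately have U_cov: "closed_discrete_coverable X A U"
      by (rule closed_discrete_coverable_subset)
    obtain x where x: "x \<in> U" "x \<in> Y"
      using V(2) U(2) by blast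
    then obtain B where "B \<in> \<B>" "x \<in> B" "B \<subseteq> U"
      using \<B>(3) U(1) by metis
    then have "x \<in> W"
      using closed_discrete_coverable_subset[OF U_cov] by (auto simp: W_def)
    then show False
      using x by (simp add: Y_def)
  qed
  have "topspace (subtopology X Y) \<noteq> {}"
    using \<open>Y \<noteq> {}\<close> by (auto simp: Y_def)
  then obtain f where f: "continuous_map Cantor_space (subtopology X Y) f"
      "\<And>\<alpha> \<beta>. (\<alpha>, \<beta>) \<in> A2 \<Longrightarrow> (f \<alpha>, f \<beta>) \<in> A"
    using A2_homomorphism[OF completely_metrizable_space_closedin[OF X(1) \<open>closedin X Y\<close>] _ meets]
    by blast
  then show thesis
    using that continuous_map_into_fulltopology by blast
qed

section \<open>The dichotomy\<close>

theorem theorem4p4: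
  fixes X :: "'a topology" and A :: "('a \<times> 'a) set"
  assumes "Polish_topology X"
    and "analytic_in (prod_topology X X) A"
  shows "(\<exists>c :: 'a \<Rightarrow> nat. Delta02_measurable X c \<and> (\<forall>(x, y)\<in>A. c x \<noteq> c y)) \<longleftrightarrow>
    \<not> (\<exists>f :: (nat \<Rightarrow> bool) \<Rightarrow> 'a. continuous_map Cantor_space X f \<and>
        (\<forall>(\<alpha>, \<beta>)\<in>A2. (f \<alpha>, f \<beta>) \<in> A))"
proof
  assume "\<exists>c :: 'a \<Rightarrow> nat. Delta02_measurable X c \<and> (\<forall>(x, y)\<in>A. c x \<noteq> c y)"
  then obtain c :: "'a \<Rightarrow> nat" where c: "Delta02_measurable X c" "\<forall>(x, y)\<in>A. c x \<noteq> c y"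
    by blast
  show "\<not> (\<exists>f. continuous_map Cantor_space X f \<and> (\<forall>(\<alpha>, \<beta>)\<in>A2. (f \<alpha>, f \<beta>) \<in> A))"
  proof
    assume "\<exists>f. continuous_map Cantor_space X f \<and> (\<forall>(\<alpha>, \<beta>)\<in>A2. (f \<alpha>, f \<beta>) \<in> A)"
    then obtain f where f: "continuous_map Cantor_space X f" "\<forall>(\<alpha>, \<beta>)\<in>A2. (f \<alpha>, f \<beta>) \<in> A"
      by blast
    have f_in: "f \<alpha> \<in> topspace X" for \<alpha>
      using f(1) by (auto simp: continuous_map_def)
    \<comment> \<open>The colouring is pulled back along \<open>f\<close> to the Cantor
      space.\<close>
    have "fsigma_in Cantor_space {\<alpha>. (c \<circ> f) \<alpha> = k}" for k
      using fsigma_in_continuous_map_preimage[OF f(1), of "{x \<in> topspace X. c x = k}"] c(1) f_in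
      by (simp add: Delta02_measurable_def Delta02_in_def)
    then obtain \<alpha> \<beta> where "(\<alpha>, \<beta>) \<in> A2" "c (f \<alpha>) = c (f \<beta>)"
      by (metis A2_no_fsigma_colouring comp_apply)
    then show False
      using c(2) f(2) by blast
  qed
next
  assume no_hom: "\<not> (\<exists>f. continuous_map Cantor_space X f \<and> (\<forall>(\<alpha>, \<beta>)\<in>A2. (f \<alpha>, f \<beta>) \<in> A))"
  have A: "A \<subseteq> topspace X \<times> topspace X"
    using assms(2) continuous_map_image_subset_topspace unfolding analytic_in_def by fastforce
  have "closed_discrete_coverable X A (topspace X)"
    using colouring_or_homomorphism[OF assms(1) A] no_hom by (metis (no_types, lifting) case_prodI2)
  moreover have "metrizable_space X"
    using assms(1) by (simp add: Polish_topology_def completely_metrizable_imp_metrizable_space)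
  ultimately obtain c where "Delta02_measurable X c" "\<And>x y. (x, y) \<in> A \<Longrightarrow> c x \<noteq> c y"
    using closed_discrete_coverable_imp_colouring A by metis
  then show "\<exists>c :: 'a \<Rightarrow> nat. Delta02_measurable X c \<and> (\<forall>(x, y)\<in>A. c x \<noteq> c y)"
    by blast
qed

end
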